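(* Let $\mathcal H$ be a real Hilbert space and let $f:\mathcal H\to\mathbb R$ be a convex differentiable function with $\operatorname{argmin}_{\mathcal H} f\neq\emptyset$. Let $x(\cdot)$ be a solution trajectory of $$\ddot x(t)+\gamma(t)\dot x(t)+\beta(t)\nabla^2 f(x(t))\dot x(t)+b(t)\nabla f(x(t))=0 .$$ Suppose that $\gamma(\cdot)$, $\beta(\cdot)$ and $b(\cdot)$ are $C^1$ functions on $[t_0,+\infty[$, with values in $\mathbb R_+$, such that there exist auxiliary functions $c(t),\theta(t),\sigma(t),\xi(t)$, with $\xi$ nonnegative, that satisfy the following conditions (the variable $t$ being omitted): (i) $\frac{d}{dt}(\beta\theta\sigma)-\theta b\sigma\le 0$; (ii) $\frac{d}{dt}\left(c^2b+\beta\theta\sigma\right)-\theta b\sigma\le 0$; (iii) $b(c^2-\theta)+\beta\theta(\sigma-\gamma)+\frac{d}{dt}(\beta\theta)=0$; (iv) $\frac{d}{dt}(\theta\sigma)+\theta\sigma(\sigma-\gamma)+\xi=0$; (v) $\frac{d}{dt}(\theta\sigma^2+\xi)\le 0$; (vi) $\dot\theta+2(\sigma-\gamma)\theta\le 0$; (vii) $\beta\left(\beta\dot\theta+2(\dot\beta-b)\theta\right)\le 0$. Set $$\mathcal E(t):=c(t)^2b(t)\left(f(x(t))-f(z)\right)+\frac{\theta(t)\sigma(t)^2}{2}\|v(t)\|^2+\frac{\xi(t)}{2}\|x(t)-z\|^2,$$ with $z\in\operatorname{argmin}_{\mathcal H} f$ and $v(t)=x(t)-z+\frac{1}{\sigma(t)}\left(\dot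 x(t)+\beta(t)\nabla f(x(t))\right)$. Then $t\mapsto\mathcal E(t)$ is a nonincreasing function. As a consequence: (1) for all $t\ge t_0$, $\displaystyle f(x(t))-\min_{\mathcal H} f\le\frac{\mathcal E(t_0)}{c(t)^2b(t)}$; (2) $\displaystyle\int_{t_0}^{+\infty}\left(\theta(t)b(t)\sigma(t)-\frac{d}{dt}\left(c^2b+\beta\theta\sigma\right)(t)\right)\left(f(x(t))-\inf_{\mathcal H} f\right)dt<+\infty$; (3) $\displaystyle\int_{t_0}^{+\infty}\left(b(t)\theta(t)\beta(t)-\frac12\frac{d}{dt}\left(\theta\beta^2\right)(t)\right)\|\nabla f(x(t))\|^2dt<+\infty$.
   Context: $\mathbb R_+$ denotes the nonnegative reals. $\nabla f$ and $\nabla^2 f$ denote the gradient and the Hessian of $f$; a dot denotes the derivative with respect to $t$. Existence of solution trajectories $x:[t_0,+\infty[\to\mathcal H$ is taken for granted.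
   Formalization: Estimates (1)–(3) are proved under the extra condition θ ≥ 0 on [t0,+∞[, without which they are false (E can be negative); σ is assumed nonzero, the derivatives in (i)–(vii) to exist, and (1) is stated where c²b ≠ 0. Monotonicity of E needs no sign of θ. *)

theory Defs
  imports "HOL-Analysis.Analysis"
begin

(* Derivative of a curve on the half-line {t0..}: one-sided at t0, two-sided at t > t0.
   Values of the curve to the left of t0 play no role. *)
definition ddt :: "real \<Rightarrow> (real \<Rightarrow> 'a::real_normed_vector) \<Rightarrow> real \<Rightarrow> 'a"
  where "ddt t0 g t = vector_derivative g (at t within {t0..})"

definition C1_from :: "real \<Rightarrow> (real \<Rightarrow> real) \<Rightarrow> bool"
  where "C1_from t0 g \<longleftrightarrow> g differentiable_on {t0..} \<and> continuous_on {t0..} (ddt t0 g)"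

definition argmin_set :: "('a \<Rightarrow> real) \<Rightarrow> 'a set"
  where "argmin_set f = {z. is_arg_min f (\<lambda>_. True) z}"

definition gradient :: "('a::real_inner \<Rightarrow> real) \<Rightarrow> 'a \<Rightarrow> 'a"
  where "gradient f p = (THE D. GDERIV f p :> D)"

definition hessian :: "('a::real_inner \<Rightarrow> real) \<Rightarrow> 'a \<Rightarrow> 'a \<Rightarrow> 'a"
  where "hessian f p = frechet_derivative (gradient f) (at p)"

(* The equation involves the Hessian of f at the points of the trajectory, so its existence
   there (Frechet differentiability of the gradient) is part of being a solution;
   no second-order regularity of f is required elsewhere. *)
definition solution_trajectory ::
  "real \<Rightarrow> (real \<Rightarrow> real) \<Rightarrow> (real \<Rightarrow> real) \<Rightarrow> (real \<Rightarrow> real) \<Rightarrow> ('a::real_inner \<Rightarrow> real) \<Rightarrow> (real \<Rightarrow> 'a) \<Rightarrow> bool"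
  where "solution_trajectory t0 \<gamma> \<beta> b f x \<longleftrightarrow>
    x differentiable_on {t0..} \<and> ddt t0 x differentiable_on {t0..} \<and>
    (\<forall>t\<ge>t0. gradient f differentiable (at (x t)) \<and>
      ddt t0 (ddt t0 x) t + \<gamma> t *\<^sub>R ddt t0 x t
        + \<beta> t *\<^sub>R hessian f (x t) (ddt t0 x t) + b t *\<^sub>R gradient f (x t) = 0)"

definition aux_v ::
  "real \<Rightarrow> ('a::real_inner \<Rightarrow> real) \<Rightarrow> (real \<Rightarrow> real) \<Rightarrow> (real \<Rightarrow> real) \<Rightarrow> (real \<Rightarrow> 'a) \<Rightarrow> 'a \<Rightarrow> real \<Rightarrow> 'a"
  where "aux_v t0 f \<beta> \<sigma> x z t =
    x t - z + (1 / \<sigma> t) *\<^sub>R (ddt t0 x t + \<beta> t *\<^sub>R gradient f (x t))"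

definition energy ::
  "real \<Rightarrow> ('a::real_inner \<Rightarrow> real) \<Rightarrow> (real \<Rightarrow> real) \<Rightarrow> (real \<Rightarrow> real) \<Rightarrow> (real \<Rightarrow> real) \<Rightarrow> (real \<Rightarrow> real)
    \<Rightarrow> (real \<Rightarrow> real) \<Rightarrow> (real \<Rightarrow> real) \<Rightarrow> (real \<Rightarrow> 'a) \<Rightarrow> 'a \<Rightarrow> real \<Rightarrow> real"
  where "energy t0 f \<beta> b c \<theta> \<sigma> \<xi> x z t =
    (c t)\<^sup>2 * b t * (f (x t) - f z)
      + \<theta> t * (\<sigma> t)\<^sup>2 / 2 * (norm (aux_v t0 f \<beta> \<sigma> x z t))\<^sup>2
      + \<xi> t / 2 * (norm (x t - z))\<^sup>2"

end

theory Submission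
  imports Defs
begin

text \<open>
  Write \<open>w = x' + \<beta> \<nabla>f(x)\<close> and \<open>y = x - z\<close>, so that \<open>\<sigma> v = \<sigma> y + w\<close>. The Hessian term
  of the differential equation is exactly what arises when \<open>\<beta> \<nabla>f(x)\<close> is differentiated along the
  trajectory, so \<open>w' = (\<beta>' - b) \<nabla>f(x) - \<gamma> x'\<close> contains no second derivative of \<open>x\<close> or \<open>f\<close>.
  Expanding the square in the energy yields

  \<open>E = c\<^sup>2 b (f(x) - f(z)) + (\<theta> \<sigma>\<^sup>2 + \<xi>)/2 |y|\<^sup>2 + \<theta> \<sigma> <y, w> + \<theta>/2 |w|\<^sup>2\<close>,

  and this form matters: its four coefficients are differentiable, while \<open>\<sigma>\<close> and \<open>\<xi>\<close> individually
  need not be where \<open>\<theta>\<close> vanishes.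

  Differentiating and collecting inner products, the coefficient of \<open><y, x'>\<close> vanishes by (iv) and that
  of \<open><x', \<nabla>f(x)>\<close> by (iii); the coefficients of \<open>|y|\<^sup>2\<close>, \<open>|x'|\<^sup>2\<close> and \<open>|\<nabla>f(x)|\<^sup>2\<close> are nonpositive by (v), (vi)
  and (vii). The coefficient of \<open><y, \<nabla>f(x)>\<close> is nonpositive by (i), so convexity, in the form
  \<open><y, \<nabla>f(x)> \<ge> f(x) - f(z)\<close>, moves that term to the function values, where (ii) controls the total.
  The result is

  \<open>E' \<le> - P (f(x) - f(z)) - Q |\<nabla>f(x)|\<^sup>2\<close>

  with \<open>P, Q \<ge> 0\<close> the two weights of the integral estimates, and monotonicity follows at once. Now
  let \<open>\<theta> \<ge> 0\<close>. The quadratic terms of the energy are nonnegative, and discarding them gives the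
  pointwise bound. For the integrals, \<open>E\<close> is nonnegative and nonincreasing, so \<open>-E'\<close> has integral at most \<open>E(t\<^sub>0)\<close> and dominates both integrands.
  Here \<open>E'\<close> and the weights are mere derivatives, possibly discontinuous; their measurability comes from
  writing a derivative as a limit of difference quotients.
\<close>

section \<open>Gradients in Hilbert space\<close>

text \<open>
  The representing vector is the minimizer of \<open>|h|\<^sup>2 - 2 \<phi> h\<close>. By the parallelogram law every minimizing
  sequence is Cauchy, so completeness provides the minimizer, and stationarity along each line
  through it is the asserted identity.
\<close>

lemma Riesz_representation:
  fixes \<phi> :: "'a::{real_inner, complete_space} \<Rightarrow> real"
  assumes "bounded_linear \<phi>"
  shows "\<exists>d. \<phi> = (\<lambda>h. inner h d)"
proof -
  interpret \<phi>: bounded_linear \<phi> by fact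
  define J where "J h = inner h h - 2 * \<phi> h" for h
  obtain K where K: "\<And>h. \<bar>\<phi> h\<bar> \<le> norm h * K"
    using \<phi>.bounded by (auto simp: real_norm_def)
  have lower: "- K\<^sup>2 \<le> J h" for h
  proof -
    have "0 \<le> (norm h - K)\<^sup>2" by simp
    then show ?thesis
      using K[of h] unfolding J_def by (simp add: power2_norm_eq_inner[symmetric] power2_diff)
  qed
  then have bdd: "bdd_below (range J)" by (auto intro!: bdd_belowI)
  define m where "m = Inf (range J)"
  have m: "m \<le> J h" for h
    unfolding m_def using bdd by (simp add: cInf_lower)
  have "\<exists>h. J h < m + 1 / Suc n" for n
    using cInf_lessD[of "range J" "m + 1 / Suc n"] unfolding m_def by auto
  then obtain u where u: "\<And>n. J (u n) < m + 1 / Suc n" by metis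
  \<comment> \<open>the linear part of \<open>J\<close> cancels in the parallelogram law\<close>
  have parallelogram: "(dist h k)\<^sup>2 = 2 * J h + 2 * J k - 4 * J ((1/2) *\<^sub>R (h + k))" for h k
    unfolding J_def dist_norm power2_norm_eq_inner
    by (simp add: inner_simps \<phi>.add \<phi>.scaleR inner_commute algebra_simps)
  have "Cauchy u"
  proof (rule metric_CauchyI)
    fix e :: real assume e: "e > 0"
    obtain N where N: "4 / e\<^sup>2 < real N" using reals_Archimedean2 by blast
    have "dist (u i) (u j) < e" if "i \<ge> N" "j \<ge> N" for i j
    proof -
      have small: "1 / real (Suc k) < e\<^sup>2 / 4" if "k \<ge> N" for k
      proof -
        have "4 / e\<^sup>2 < real (Suc k)" using N that by linarith
        then show ?thesis using e by (simp add: field_simps)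
      qed
      have "(dist (u i) (u j))\<^sup>2 < e\<^sup>2"
        using parallelogram[of "u i" "u j"] m[of "(1/2) *\<^sub>R (u i + u j)"] u[of i] u[of j]
          small[OF that(1)] small[OF that(2)] by linarith
      then show ?thesis using e by (simp add: power_less_imp_less_base)
    qed
    then show "\<exists>N. \<forall>i\<ge>N. \<forall>j\<ge>N. dist (u i) (u j) < e" by blast
  qed
  then obtain d where d: "u \<longlonglongrightarrow> d" using Cauchy_convergent_iff convergent_def by blast
  have "(\<lambda>n. J (u n)) \<longlonglongrightarrow> J d"
    unfolding J_def by (intro tendsto_intros \<phi>.tendsto d)
  moreover have "(\<lambda>n. m + 1 / Suc n) \<longlonglongrightarrow> m"
    using tendsto_add[OF tendsto_const LIMSEQ_inverse_real_of_nat, of m]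
    by (simp add: inverse_eq_divide)
  ultimately have min: "J d \<le> m"
    using LIMSEQ_le less_imp_le[OF u] by blast
  have "\<phi> h = inner h d" for h
  proof -
    define g where "g s = J (d + s *\<^sub>R h)" for s :: real
    have g: "g s = J d + 2 * s * (inner h d - \<phi> h) + s\<^sup>2 * inner h h" for s
      unfolding g_def J_def
      by (simp add: inner_simps \<phi>.add \<phi>.scaleR inner_commute power2_eq_square algebra_simps)
    have "(g has_real_derivative 2 * (inner h d - \<phi> h)) (at 0)"
      unfolding g[abs_def] by (auto intro!: derivative_eq_intros)
    then have "2 * (inner h d - \<phi> h) = 0"
    proof (rule DERIV_local_min[of _ _ _ 1])
      show "\<forall>y. \<bar>0 - y\<bar> < 1 \<longrightarrow> g 0 \<le> g y"
        using min m by (auto simp: g_def intro: order_trans)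
    qed simp
    then show ?thesis by simp
  qed
  then show ?thesis by auto
qed

text \<open>
  The gradient is a definite description; Riesz representation is what makes it denote something
  for a Frechet differentiable function.
\<close>
lemma GDERIV_gradient:
  fixes f :: "'a::{real_inner, complete_space} \<Rightarrow> real"
  assumes "f differentiable (at p)"
  shows "GDERIV f p :> gradient f p"
proof -
  obtain f' where f': "(f has_derivative f') (at p)"
    using assms by (auto simp: differentiable_def)
  obtain d where "f' = (\<lambda>h. inner h d)"
    using Riesz_representation[OF has_derivative_bounded_linear[OF f']] by auto
  with f' have d: "GDERIV f p :> d" by (simp add: gderiv_def)
  moreover have "d' = d" if "GDERIV f p :> d'" for d'
  proof -
    have "(\<lambda>h. inner h d') = (\<lambda>h. inner h d)"
      using that d unfolding gderiv_def by (rule has_derivative_unique)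
    then have "\<forall>h. inner h d' = inner h d" by (simp add: fun_eq_iff)
    then show ?thesis by (simp only: vector_eq_ldot)
  qed
  ultimately show ?thesis
    unfolding gradient_def by (rule theI)
qed

lemma convex_above_tangent_GDERIV:
  fixes f :: "'a::real_inner \<Rightarrow> real"
  assumes conv: "convex_on UNIV f" and grad: "GDERIV f p :> g"
  shows "f p + inner (q - p) g \<le> f q"
proof -
  define h where "h s = f (p + s *\<^sub>R (q - p))" for s :: real
  have "convex_on UNIV h"
  proof (rule convex_onI)
    fix s u v :: real assume s: "0 < s" "s < 1"
    have "p + ((1 - s) *\<^sub>R u + s *\<^sub>R v) *\<^sub>R (q - p)
        = (1 - s) *\<^sub>R (p + u *\<^sub>R (q - p)) + s *\<^sub>R (p + v *\<^sub>R (q - p))"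
      by (simp add: algebra_simps)
    then show "h ((1 - s) *\<^sub>R u + s *\<^sub>R v) \<le> (1 - s) * h u + s * h v"
      unfolding h_def using convex_onD[OF conv, of s] s by (metis UNIV_I less_imp_le)
  qed simp
  moreover have "(h has_real_derivative inner (q - p) g) (at 0)"
  proof -
    have "((\<lambda>s. p + s *\<^sub>R (q - p)) has_vector_derivative (q - p)) (at 0)"
      by (auto intro!: derivative_eq_intros)
    moreover have "(f has_derivative (\<lambda>k. inner k g)) (at (p + 0 *\<^sub>R (q - p)))"
      using grad by (simp add: gderiv_def)
    ultimately show ?thesis
      unfolding h_def[abs_def] has_real_derivative_iff_has_vector_derivative
      using vector_derivative_diff_chain_within[of _ _ 0 UNIV, OF _ has_derivative_at_withinI]
      unfolding o_def by blast
  qed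
  ultimately have "h 1 - h 0 \<ge> inner (q - p) g * (1 - 0)"
    by (intro convex_on_imp_above_tangent[of UNIV]) auto
  then show ?thesis by (simp add: h_def)
qed

section \<open>Derivatives on a half-line\<close>

lemma ddt_has_vector_derivative:
  assumes "g differentiable_on {t0..}" "t \<ge> t0"
  shows "(g has_vector_derivative ddt t0 g t) (at t within {t0..})"
  using assms unfolding ddt_def differentiable_on_def
  by (simp add: vector_derivative_works[symmetric])

lemma ddt_eqI:
  assumes "(g has_vector_derivative d) (at t within {t0..})" "t \<ge> t0"
  shows "ddt t0 g t = d"
  unfolding ddt_def
proof (rule vector_derivative_within[OF _ assms(1)])
  have "t islimpt {t0..}"
    using assms(2) by (intro islimpt_subset[of t "{t..t + 1}" "{t0..}"]) auto
  then show "at t within {t0..} \<noteq> bot"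
    by (simp add: trivial_limit_within)
qed

text \<open>
  Approaching from the right gives quotients that only look at the half-line, including at its
  endpoint, where the derivative is one-sided.
\<close>
lemma ddt_diff_quotient_LIMSEQ:
  fixes g :: "real \<Rightarrow> real"
  assumes "g differentiable_on {t0..}" "t \<ge> t0"
  shows "(\<lambda>n. (g (t + 1 / Suc n) - g t) * Suc n) \<longlonglongrightarrow> ddt t0 g t"
proof -
  have "((\<lambda>y. (g y - g t) / (y - t)) \<longlongrightarrow> ddt t0 g t) (at t within {t0..})"
    using ddt_has_vector_derivative[OF assms]
    unfolding has_real_derivative_iff_has_vector_derivative[symmetric] has_field_derivative_iff .
  moreover have "filterlim (\<lambda>n. t + 1 / Suc n) (at t within {t0..}) sequentially"
    unfolding filterlim_at
  proof
    show "(\<lambda>n. t + 1 / Suc n) \<longlonglongrightarrow> t"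
      using tendsto_add[OF tendsto_const LIMSEQ_inverse_real_of_nat, of t]
      by (simp add: inverse_eq_divide)
    have "t + 1 / Suc n \<in> {t0..} \<and> t + 1 / Suc n \<noteq> t" for n
      using assms(2) by (simp add: add_increasing2)
    then show "\<forall>\<^sub>F n in sequentially. t + 1 / Suc n \<in> {t0..} \<and> t + 1 / Suc n \<noteq> t"
      by (intro always_eventually allI)
  qed
  ultimately have "(\<lambda>n. (g (t + 1 / Suc n) - g t) / (t + 1 / Suc n - t)) \<longlonglongrightarrow> ddt t0 g t"
    by (rule filterlim_compose)
  then show ?thesis by simp
qed

lemma set_borel_measurable_ddt:
  fixes g :: "real \<Rightarrow> real"
  assumes "g differentiable_on {t0..}"
  shows "set_borel_measurable lborel {t0..} (ddt t0 g)"
proof -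
  have cont: "continuous_on {t0..} g" by (rule differentiable_imp_continuous_on[OF assms])
  have "set_borel_measurable lborel {t0..} (\<lambda>t. (g (t + 1 / Suc n) - g t) * Suc n)" for n
    unfolding set_borel_measurable_def
    by (subst measurable_lborel2, rule borel_measurable_continuous_on_indicator)
      (auto intro!: continuous_intros continuous_on_compose2[OF cont] cont add_increasing2)
  then show ?thesis
    unfolding set_borel_measurable_def
    by (rule borel_measurable_LIMSEQ_real[rotated])
      (use ddt_diff_quotient_LIMSEQ[OF assms] in \<open>auto simp: indicator_def\<close>)
qed

lemma set_borel_measurable_mult:
  fixes g h :: "real \<Rightarrow> real"
  assumes "set_borel_measurable M A g" "set_borel_measurable M A h"
  shows "set_borel_measurable M A (\<lambda>t. g t * h t)"
proof -
  have "(\<lambda>t. indicator A t *\<^sub>R (g t * h t)) = (\<lambda>t. (indicator A t *\<^sub>R g t) * (indicator A t *\<^sub>R h t))"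
    by (auto simp: indicator_def)
  then show ?thesis
    using assms unfolding set_borel_measurable_def by simp
qed

lemma set_borel_measurable_diff:
  fixes g h :: "real \<Rightarrow> real"
  assumes "set_borel_measurable M A g" "set_borel_measurable M A h"
  shows "set_borel_measurable M A (\<lambda>t. g t - h t)"
  using assms unfolding set_borel_measurable_def by (simp add: right_diff_distrib)

lemma set_borel_measurable_continuous_on:
  fixes g :: "real \<Rightarrow> real"
  assumes "continuous_on {t0..} g"
  shows "set_borel_measurable lborel {t0..} g"
  using borel_measurable_continuous_on_indicator[OF _ assms]
  unfolding set_borel_measurable_def by simp

lemma antimono_on_if_derivative_nonpos:
  fixes E :: "real \<Rightarrow> real"
  assumes deriv: "\<And>t. t \<ge> t0 \<Longrightarrow> (E has_vector_derivative D t) (at t within {t0..})"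
    and nonpos: "\<And>t. t \<ge> t0 \<Longrightarrow> D t \<le> 0"
  shows "antimono_on {t0..} E"
proof (rule monotone_onI)
  fix r s assume rs: "r \<in> {t0..}" "s \<in> {t0..}" "r \<le> s"
  show "E s \<le> E r"
  proof (rule DERIV_nonpos_imp_decreasing_open[OF rs(3)])
    fix t assume t: "r < t" "t < s"
    then have "at t within {t0..} = at t"
      using rs by (intro at_within_interior) (auto simp: interior_real_atLeast)
    then show "\<exists>y. DERIV E t :> y \<and> y \<le> 0"
      using deriv[of t] nonpos[of t] t rs
      by (auto simp: has_real_derivative_iff_has_vector_derivative)
  next
    have "continuous_on {t0..} E"
      using deriv by (intro continuous_on_vector_derivative) auto
    then show "continuous_on {r..s} E"
      by (rule continuous_on_subset) (use rs in auto)
  qed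
qed

section \<open>Integrability from dissipation\<close>

text \<open>
  On each interval \<open>{t0..t0 + n}\<close> the fundamental theorem of calculus, valid for the gauge integral
  with no regularity of \<open>D\<close>, gives \<open>-D\<close> the integral \<open>E t0 - E (t0 + n)\<close>. As \<open>-D\<close> is nonnegative and
  measurable this is also its Lebesgue integral, and since \<open>E\<close> decreases to a finite limit, monotone
  convergence makes \<open>-D\<close> integrable on the half-line; \<open>g\<close> lies between \<open>0\<close> and \<open>-D\<close>.
\<close>
lemma set_integrable_dissipation:
  fixes E :: "real \<Rightarrow> real"
  assumes deriv: "\<And>t. t \<ge> t0 \<Longrightarrow> (E has_vector_derivative D t) (at t within {t0..})"
    and nonneg: "\<And>t. t \<ge> t0 \<Longrightarrow> 0 \<le> E t"
    and bound: "\<And>t. t \<ge> t0 \<Longrightarrow> 0 \<le> g t \<and> g t \<le> - D t"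
    and meas: "set_borel_measurable lborel {t0..} g"
  shows "set_integrable lborel {t0..} g"
proof -
  have D: "ddt t0 E t = D t" if "t \<ge> t0" for t
    using ddt_eqI[OF deriv[OF that] that] .
  have D0: "D t \<le> 0" if "t \<ge> t0" for t using bound[OF that] by linarith
  have antimono: "antimono_on {t0..} E"
    using deriv D0 by (rule antimono_on_if_derivative_nonpos)
  define u where "u t = indicator {t0..} t * - D t" for t
  define U where "U n t = indicator {t0..t0 + real n} t * u t" for n t
  have "set_borel_measurable lborel {t0..} (ddt t0 E)"
    using deriv by (intro set_borel_measurable_ddt)
      (auto simp: differentiable_on_def has_vector_derivative_def differentiable_def)
  also have "(\<lambda>t. indicator {t0..} t *\<^sub>R ddt t0 E t) = (\<lambda>t. - u t)"
    by (auto simp: u_def indicator_def D)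
  then have "set_borel_measurable lborel {t0..} (ddt t0 E) \<longleftrightarrow> (\<lambda>t. - u t) \<in> borel_measurable lborel"
    by (simp add: set_borel_measurable_def)
  finally have u_meas: "u \<in> borel_measurable borel" by simp
  have u0: "0 \<le> u t" for t by (simp add: u_def indicator_def D0)
  have U: "has_bochner_integral lborel (U n) (E t0 - E (t0 + real n))" for n
  proof (rule has_bochner_integral_nn_integral)
    show "U n \<in> borel_measurable lborel" unfolding U_def using u_meas by simp
    show "AE t in lborel. 0 \<le> U n t" by (simp add: U_def u0)
    show "0 \<le> E t0 - E (t0 + real n)"
      using monotone_onD[OF antimono, of t0 "t0 + real n"] by simp
    have "((\<lambda>t. - D t) has_integral (- E (t0 + real n) - - E t0)) {t0..t0 + real n}"
      by (rule fundamental_theorem_of_calculus)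
        (auto intro!: has_vector_derivative_minus has_vector_derivative_within_subset[OF deriv])
    then have "((\<lambda>t. if t \<in> {t0..t0 + real n} then - D t else 0)
        has_integral (E t0 - E (t0 + real n))) UNIV"
      by (subst has_integral_restrict_UNIV) simp
    then have "(U n has_integral (E t0 - E (t0 + real n))) UNIV"
      by (rule has_integral_eq[rotated]) (auto simp: U_def u_def indicator_def)
    then show "(\<integral>\<^sup>+ t. ennreal (U n t) \<partial>lborel) = ennreal (E t0 - E (t0 + real n))"
      by (intro nn_integral_has_integral_lborel)
        (use u_meas in \<open>simp_all add: U_def[abs_def] u0\<close>)
  qed
  have "decseq (\<lambda>n. E (t0 + real n))"
    using antimono by (auto simp: decseq_def monotone_on_def)
  then obtain L where L: "(\<lambda>n. E (t0 + real n)) \<longlonglongrightarrow> L"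
  proof (rule decseq_convergent)
    show "\<forall>n. 0 \<le> E (t0 + real n)" using nonneg by simp
  qed
  have u_int: "integrable lborel u"
  proof (rule integrable_monotone_convergence)
    show "integrable lborel (U n)" for n using U by (rule integrable.intros)
    show "AE t in lborel. mono (\<lambda>n. U n t)"
      by (auto simp: mono_def U_def u0 indicator_def intro!: AE_I2)
    show "AE t in lborel. (\<lambda>n. U n t) \<longlonglongrightarrow> u t"
    proof (rule AE_I2)
      fix t
      obtain N :: nat where N: "t - t0 < real N" using reals_Archimedean2 by blast
      have "\<forall>n\<ge>N. U n t = u t"
        using N by (auto simp: U_def u_def indicator_def)
      then show "(\<lambda>n. U n t) \<longlonglongrightarrow> u t"
        by (intro tendsto_eventually) (auto simp: eventually_sequentially)
    qed
    show "(\<lambda>n. integral\<^sup>L lborel (U n)) \<longlonglongrightarrow> E t0 - L"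
      using U[THEN has_bochner_integral_integral_eq] L by (auto intro!: tendsto_intros)
    show "u \<in> borel_measurable lborel" using u_meas by simp
  qed
  show ?thesis
    unfolding set_integrable_def
  proof (rule Bochner_Integration.integrable_bound[OF u_int])
    show "AE t in lborel. norm (indicator {t0..} t *\<^sub>R g t) \<le> norm (u t)"
      using bound by (fastforce simp: u_def indicator_def intro!: AE_I2)
  qed (use meas in \<open>simp add: set_borel_measurable_def\<close>)
qed


section \<open>The derivative of the energy\<close>

lemma quadratic_energy_has_vector_derivative:
  fixes y w :: "real \<Rightarrow> 'a::real_inner" and q p m \<theta> \<phi> :: "real \<Rightarrow> real"
  assumes "(q has_vector_derivative q') (at t within S)"
    and "(p has_vector_derivative p') (at t within S)"
    and "(m has_vector_derivative m') (at t within S)"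
    and "(\<theta> has_vector_derivative \<theta>') (at t within S)"
    and "(\<phi> has_vector_derivative \<phi>') (at t within S)"
    and "(y has_vector_derivative y') (at t within S)"
    and "(w has_vector_derivative w') (at t within S)"
  shows "((\<lambda>s. q s * \<phi> s + p s / 2 * inner (y s) (y s) + m s * inner (y s) (w s)
        + \<theta> s / 2 * inner (w s) (w s)) has_vector_derivative
      (q' * \<phi> t + q t * \<phi>' + p' / 2 * inner (y t) (y t) + p t * inner (y t) y'
        + m' * inner (y t) (w t) + m t * (inner y' (w t) + inner (y t) w')
        + \<theta>' / 2 * inner (w t) (w t) + \<theta> t * inner (w t) w')) (at t within S)"
proof -
  note inner_deriv = bounded_bilinear.has_vector_derivative[OF bounded_bilinear_inner]
  have half: "((\<lambda>s. k s / 2) has_vector_derivative k' / 2) (at t within S)"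
    if "(k has_vector_derivative k') (at t within S)" for k :: "real \<Rightarrow> real" and k'
    using has_vector_derivative_mult_right[OF that, of "1/2"] by simp
  note sum_deriv = has_vector_derivative_add[OF has_vector_derivative_add[OF has_vector_derivative_add]]
  show ?thesis
    using sum_deriv[OF has_vector_derivative_mult[OF assms(1) assms(5)]
        has_vector_derivative_mult[OF half[OF assms(2)] inner_deriv[OF assms(6) assms(6)]]
        has_vector_derivative_mult[OF assms(3) inner_deriv[OF assms(6) assms(7)]]
        has_vector_derivative_mult[OF half[OF assms(4)] inner_deriv[OF assms(7) assms(7)]]]
    by (rule has_vector_derivative_eq_rhs) (simp add: inner_commute algebra_simps)
qed

text \<open>
  The derivative of the energy, rearranged as a quadratic form in \<open>y = x - z\<close>, \<open>v = x'\<close> and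
  \<open>g = \<nabla>f(x)\<close>. For \<open>q = c\<^sup>2 b\<close>, \<open>p = \<theta> \<sigma>\<^sup>2 + \<xi>\<close> and \<open>m = \<theta> \<sigma>\<close>, each of the conditions (iii)--(vii) of the
  theorem is a statement about one coefficient on the right, and (i), (ii) govern the coefficients of \<open><y, g>\<close> and \<open>\<phi>\<close> together.
\<close>
lemma dissipation_identity:
  fixes y v g w w' :: "'a::real_inner"
  assumes w: "w = v + \<beta> *\<^sub>R g" and w': "w' = (\<beta>' - b) *\<^sub>R g - \<gamma> *\<^sub>R v"
  shows "q' * \<phi> + q * inner v g + p' / 2 * inner y y + p * inner y v
        + m' * inner y w + m * (inner v w + inner y w') + \<theta>' / 2 * inner w w + \<theta> * inner w w'
      = q' * \<phi> + p' / 2 * inner y y + (p + m' - m * \<gamma>) * inner y v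
        + (m' * \<beta> + m * (\<beta>' - b)) * inner y g + (\<theta>' / 2 + m - \<theta> * \<gamma>) * inner v v
        + (q + m * \<beta> + \<theta>' * \<beta> + \<theta> * (\<beta>' - b) - \<gamma> * \<beta> * \<theta>) * inner v g
        + \<beta> * (\<beta> * \<theta>' + 2 * (\<beta>' - b) * \<theta>) / 2 * inner g g"
proof -
  have "inner y w = inner y v + \<beta> * inner y g"
    and "inner v w = inner v v + \<beta> * inner v g"
    and "inner y w' = (\<beta>' - b) * inner y g - \<gamma> * inner y v"
    and "inner w w = inner v v + 2 * \<beta> * inner v g + \<beta> * \<beta> * inner g g"
    and "inner w w' = (\<beta>' - b) * (inner v g + \<beta> * inner g g) - \<gamma> * (inner v v + \<beta> * inner v g)"
    unfolding w w' by (simp_all add: inner_simps inner_commute[of g v] algebra_simps)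
  then show ?thesis
    by algebra
qed
section \<open>The Lyapunov estimate and its consequences\<close>

theorem theorem1:
  fixes f :: "'a::{real_inner, complete_space} \<Rightarrow> real"
    and x :: "real \<Rightarrow> 'a"
    and t0 :: real
    and \<gamma> \<beta> b c \<theta> \<sigma> \<xi> :: "real \<Rightarrow> real"
  assumes f_convex: "convex_on UNIV f"
    and f_diff: "f differentiable_on UNIV"
    and f_argmin: "argmin_set f \<noteq> {}"
    and traj: "solution_trajectory t0 \<gamma> \<beta> b f x"
    and C1: "C1_from t0 \<gamma>" "C1_from t0 \<beta>" "C1_from t0 b"
    and nonneg: "\<And>t. t \<ge> t0 \<Longrightarrow> \<gamma> t \<ge> 0" "\<And>t. t \<ge> t0 \<Longrightarrow> \<beta> t \<ge> 0" "\<And>t. t \<ge> t0 \<Longrightarrow> b t \<ge> 0"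
    and xi_nonneg: "\<And>t. t \<ge> t0 \<Longrightarrow> \<xi> t \<ge> 0"
    and sigma_nonzero: "\<And>t. t \<ge> t0 \<Longrightarrow> \<sigma> t \<noteq> 0"
    and aux_diff: "\<theta> differentiable_on {t0..}"
      "(\<lambda>s. \<theta> s * \<sigma> s) differentiable_on {t0..}"
      "(\<lambda>s. (c s)\<^sup>2 * b s + \<beta> s * \<theta> s * \<sigma> s) differentiable_on {t0..}"
      "(\<lambda>s. \<theta> s * (\<sigma> s)\<^sup>2 + \<xi> s) differentiable_on {t0..}"
    and i: "\<And>t. t \<ge> t0 \<Longrightarrow> ddt t0 (\<lambda>s. \<beta> s * \<theta> s * \<sigma> s) t - \<theta> t * b t * \<sigma> t \<le> 0"
    and ii: "\<And>t. t \<ge> t0 \<Longrightarrow>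
      ddt t0 (\<lambda>s. (c s)\<^sup>2 * b s + \<beta> s * \<theta> s * \<sigma> s) t - \<theta> t * b t * \<sigma> t \<le> 0"
    and iii: "\<And>t. t \<ge> t0 \<Longrightarrow>
      b t * ((c t)\<^sup>2 - \<theta> t) + \<beta> t * \<theta> t * (\<sigma> t - \<gamma> t) + ddt t0 (\<lambda>s. \<beta> s * \<theta> s) t = 0"
    and iv: "\<And>t. t \<ge> t0 \<Longrightarrow>
      ddt t0 (\<lambda>s. \<theta> s * \<sigma> s) t + \<theta> t * \<sigma> t * (\<sigma> t - \<gamma> t) + \<xi> t = 0"
    and v: "\<And>t. t \<ge> t0 \<Longrightarrow> ddt t0 (\<lambda>s. \<theta> s * (\<sigma> s)\<^sup>2 + \<xi> s) t \<le> 0"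
    and vi: "\<And>t. t \<ge> t0 \<Longrightarrow> ddt t0 \<theta> t + 2 * (\<sigma> t - \<gamma> t) * \<theta> t \<le> 0"
    and vii: "\<And>t. t \<ge> t0 \<Longrightarrow>
      \<beta> t * (\<beta> t * ddt t0 \<theta> t + 2 * (ddt t0 \<beta> t - b t) * \<theta> t) \<le> 0"
  shows "(\<forall>z\<in>argmin_set f. antimono_on {t0..} (energy t0 f \<beta> b c \<theta> \<sigma> \<xi> x z))
    \<and> ((\<forall>t\<ge>t0. \<theta> t \<ge> 0) \<longrightarrow>
        (\<forall>z\<in>argmin_set f. \<forall>t\<ge>t0. (c t)\<^sup>2 * b t \<noteq> 0 \<longrightarrow>
            f (x t) - (INF y. f y) \<le> energy t0 f \<beta> b c \<theta> \<sigma> \<xi> x z t0 / ((c t)\<^sup>2 * b t))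
      \<and> set_integrable lborel {t0..}
          (\<lambda>t. (\<theta> t * b t * \<sigma> t - ddt t0 (\<lambda>s. (c s)\<^sup>2 * b s + \<beta> s * \<theta> s * \<sigma> s) t)
                * (f (x t) - (INF y. f y)))
      \<and> set_integrable lborel {t0..}
          (\<lambda>t. (b t * \<theta> t * \<beta> t - 1 / 2 * ddt t0 (\<lambda>s. \<theta> s * (\<beta> s)\<^sup>2) t)
                * (norm (gradient f (x t)))\<^sup>2))"
proof -
  define grad where "grad t = gradient f (x t)" for t
  define x' where "x' = ddt t0 x"
  define w where "w t = x' t + \<beta> t *\<^sub>R grad t" for t
  define \<beta>' where "\<beta>' = ddt t0 \<beta>"
  define \<theta>' where "\<theta>' = ddt t0 \<theta>"
  define m where "m t = \<theta> t * \<sigma> t" for t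
  define m' where "m' = ddt t0 m"
  define q where "q t = (c t)\<^sup>2 * b t" for t
  define r' where "r' = ddt t0 (\<lambda>s. (c s)\<^sup>2 * b s + \<beta> s * \<theta> s * \<sigma> s)"
  define q' where "q' t = r' t - (\<beta>' t * m t + \<beta> t * m' t)" for t
  define p where "p t = \<theta> t * (\<sigma> t)\<^sup>2 + \<xi> t" for t
  define p' where "p' = ddt t0 p"
  \<comment> \<open>\<open>P\<close> and \<open>Q\<close> are the weights of the two integrands\<close>
  define P where "P t = \<theta> t * b t * \<sigma> t - r' t" for t
  define Q where "Q t = b t * \<theta> t * \<beta> t - 1 / 2 * ddt t0 (\<lambda>s. \<theta> s * (\<beta> s)\<^sup>2) t" for t

  have \<beta>_diff: "\<beta> differentiable_on {t0..}" and b_diff: "b differentiable_on {t0..}"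
    using C1 by (auto simp: C1_from_def)
  have x_diff: "x differentiable_on {t0..}" and x'_diff: "x' differentiable_on {t0..}"
    using traj by (auto simp: solution_trajectory_def x'_def)

  have \<beta>_deriv: "(\<beta> has_vector_derivative \<beta>' t) (at t within {t0..})" if "t \<ge> t0" for t
    unfolding \<beta>'_def using \<beta>_diff that by (rule ddt_has_vector_derivative)
  have \<theta>_deriv: "(\<theta> has_vector_derivative \<theta>' t) (at t within {t0..})" if "t \<ge> t0" for t
    unfolding \<theta>'_def using aux_diff(1) that by (rule ddt_has_vector_derivative)
  have m_deriv: "(m has_vector_derivative m' t) (at t within {t0..})" if "t \<ge> t0" for t
    unfolding m'_def using aux_diff(2)[folded m_def] that by (rule ddt_has_vector_derivative)
  have p_deriv: "(p has_vector_derivative p' t) (at t within {t0..})" if "t \<ge> t0" for t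
    unfolding p'_def using aux_diff(4)[folded p_def] that by (rule ddt_has_vector_derivative)
  have x_deriv: "(x has_vector_derivative x' t) (at t within {t0..})" if "t \<ge> t0" for t
    unfolding x'_def using x_diff that by (rule ddt_has_vector_derivative)
  have \<beta>m_deriv: "((\<lambda>s. \<beta> s * m s) has_vector_derivative \<beta>' t * m t + \<beta> t * m' t) (at t within {t0..})"
    if "t \<ge> t0" for t
    using has_vector_derivative_mult[OF \<beta>_deriv[OF that] m_deriv[OF that]] by (simp add: add.commute)
  \<comment> \<open>\<open>c\<^sup>2 b\<close> is differentiable as the difference of \<open>c\<^sup>2 b + \<beta> \<theta> \<sigma>\<close> and \<open>\<beta> (\<theta> \<sigma>)\<close>\<close>
  have q_deriv: "(q has_vector_derivative q' t) (at t within {t0..})" if "t \<ge> t0" for t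
  proof -
    have "q = (\<lambda>s. ((c s)\<^sup>2 * b s + \<beta> s * \<theta> s * \<sigma> s) - \<beta> s * m s)"
      by (auto simp: q_def m_def)
    then show ?thesis
      unfolding q'_def r'_def
      using has_vector_derivative_diff[OF ddt_has_vector_derivative[OF aux_diff(3) that] \<beta>m_deriv[OF that]]
      by simp
  qed
  have grad_deriv: "(grad has_vector_derivative hessian f (x t) (x' t)) (at t within {t0..})"
    if "t \<ge> t0" for t
  proof -
    have "gradient f differentiable (at (x t))"
      using traj that by (simp add: solution_trajectory_def)
    then have "(gradient f has_derivative hessian f (x t)) (at (x t))"
      unfolding hessian_def by (simp add: frechet_derivative_works)
    then show ?thesis
      using vector_derivative_diff_chain_within[OF x_deriv[OF that] has_derivative_at_withinI]
      unfolding grad_def[abs_def] o_def by blast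
  qed
  \<comment> \<open>the equation of motion: the Hessian term cancels\<close>
  have w_deriv: "(w has_vector_derivative (\<beta>' t - b t) *\<^sub>R grad t - \<gamma> t *\<^sub>R x' t) (at t within {t0..})"
    if "t \<ge> t0" for t
  proof -
    have "(w has_vector_derivative
        ddt t0 x' t + (\<beta> t *\<^sub>R hessian f (x t) (x' t) + \<beta>' t *\<^sub>R grad t)) (at t within {t0..})"
      unfolding w_def[abs_def]
      using \<beta>_deriv[OF that] grad_deriv[OF that] ddt_has_vector_derivative[OF x'_diff that]
      by (intro has_vector_derivative_add has_vector_derivative_scaleR)
        (simp_all add: has_real_derivative_iff_has_vector_derivative)
    moreover have "ddt t0 x' t + \<gamma> t *\<^sub>R x' t + \<beta> t *\<^sub>R hessian f (x t) (x' t) + b t *\<^sub>R grad t = 0"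
      using traj that by (simp add: solution_trajectory_def x'_def grad_def)
    then have "ddt t0 x' t + (\<beta> t *\<^sub>R hessian f (x t) (x' t) + \<beta>' t *\<^sub>R grad t)
        = (\<beta>' t - b t) *\<^sub>R grad t - \<gamma> t *\<^sub>R x' t"
      by (simp add: algebra_simps eq_neg_iff_add_eq_0)
    ultimately show ?thesis by simp
  qed
  have GDERIV_x: "GDERIV f (x t) :> grad t" for t
    unfolding grad_def using f_diff
    by (intro GDERIV_gradient) (simp add: differentiable_on_def)
  have fx_deriv: "((\<lambda>s. f (x s) - k) has_vector_derivative inner (x' t) (grad t)) (at t within {t0..})"
    if "t \<ge> t0" for t k
  proof -
    have "((\<lambda>s. f (x s)) has_vector_derivative inner (x' t) (grad t)) (at t within {t0..})"
      using vector_derivative_diff_chain_within[OF x_deriv[OF that]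
          has_derivative_at_withinI[OF GDERIV_x[unfolded gderiv_def]]]
      unfolding o_def .
    then show ?thesis
      using has_vector_derivative_diff[OF _ has_vector_derivative_const] by fastforce
  qed

  have P_nonneg: "0 \<le> P t" if "t \<ge> t0" for t
    using ii[OF that] by (simp add: P_def r'_def)
  have Q_eq: "Q t = - (1 / 2) * (\<beta> t * (\<beta> t * \<theta>' t + 2 * (\<beta>' t - b t) * \<theta> t))" if "t \<ge> t0" for t
  proof -
    have "((\<lambda>s. \<theta> s * (\<beta> s)\<^sup>2) has_vector_derivative
        \<theta> t * (\<beta> t * \<beta>' t + \<beta>' t * \<beta> t) + \<theta>' t * (\<beta> t * \<beta> t)) (at t within {t0..})"
      unfolding power2_eq_square
      using that by (intro has_vector_derivative_mult \<theta>_deriv \<beta>_deriv)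
    from ddt_eqI[OF this that] show ?thesis
      by (simp add: Q_def algebra_simps)
  qed
  have Q_nonneg: "0 \<le> Q t" if "t \<ge> t0" for t
    using vii[OF that] unfolding Q_eq[OF that] \<theta>'_def \<beta>'_def by simp

  have energy: "\<exists>D. \<forall>t\<ge>t0.
      (energy t0 f \<beta> b c \<theta> \<sigma> \<xi> x z has_vector_derivative D t) (at t within {t0..})
      \<and> D t \<le> - (P t * (f (x t) - f z) + Q t * (norm (grad t))\<^sup>2)"
    if z: "\<And>y. f z \<le> f y" for z
  proof -
    define \<phi> where "\<phi> t = f (x t) - f z" for t
    define y where "y t = x t - z" for t
    define D where "D t = q' t * \<phi> t + q t * inner (x' t) (grad t) + p' t / 2 * inner (y t) (y t)
        + p t * inner (y t) (x' t) + m' t * inner (y t) (w t)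
        + m t * (inner (x' t) (w t) + inner (y t) ((\<beta>' t - b t) *\<^sub>R grad t - \<gamma> t *\<^sub>R x' t))
        + \<theta>' t / 2 * inner (w t) (w t)
        + \<theta> t * inner (w t) ((\<beta>' t - b t) *\<^sub>R grad t - \<gamma> t *\<^sub>R x' t)" for t
    \<comment> \<open>the energy in terms of coefficients that are known to be differentiable\<close>
    have expand: "energy t0 f \<beta> b c \<theta> \<sigma> \<xi> x z t = q t * \<phi> t + p t / 2 * inner (y t) (y t)
        + m t * inner (y t) (w t) + \<theta> t / 2 * inner (w t) (w t)" if "t \<ge> t0" for t
    proof -
      have \<sigma>v: "\<sigma> t *\<^sub>R aux_v t0 f \<beta> \<sigma> x z t = \<sigma> t *\<^sub>R y t + w t"
        using sigma_nonzero[OF that]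
        by (simp add: aux_v_def y_def w_def x'_def grad_def scaleR_right_distrib)
      have "\<theta> t * (\<sigma> t)\<^sup>2 / 2 * (norm (aux_v t0 f \<beta> \<sigma> x z t))\<^sup>2
          = \<theta> t / 2 * inner (\<sigma> t *\<^sub>R y t + w t) (\<sigma> t *\<^sub>R y t + w t)"
        unfolding \<sigma>v[symmetric] power2_norm_eq_inner by (simp add: power2_eq_square)
      also have "\<dots> = \<theta> t * (\<sigma> t)\<^sup>2 / 2 * inner (y t) (y t) + m t * inner (y t) (w t)
          + \<theta> t / 2 * inner (w t) (w t)"
        by (simp add: m_def inner_simps inner_commute[of "w t" "y t"] algebra_simps power2_eq_square)
      finally show ?thesis
        by (simp add: energy_def power2_norm_eq_inner q_def \<phi>_def p_def y_def
            add_divide_distrib distrib_right)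
    qed
    have deriv: "(energy t0 f \<beta> b c \<theta> \<sigma> \<xi> x z has_vector_derivative D t) (at t within {t0..})"
      if t: "t \<ge> t0" for t
    proof (rule has_vector_derivative_transform)
      show "((\<lambda>t. q t * \<phi> t + p t / 2 * inner (y t) (y t) + m t * inner (y t) (w t)
          + \<theta> t / 2 * inner (w t) (w t)) has_vector_derivative D t) (at t within {t0..})"
        unfolding D_def
      proof (rule quadratic_energy_has_vector_derivative)
        show "(y has_vector_derivative x' t) (at t within {t0..})"
          using has_vector_derivative_diff[OF x_deriv[OF t] has_vector_derivative_const, of z]
          by (simp add: y_def[abs_def])
      qed (use t q_deriv p_deriv m_deriv \<theta>_deriv w_deriv fx_deriv in \<open>auto simp: \<phi>_def[abs_def]\<close>)
    qed (use t expand in auto)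
    have bound: "D t \<le> - (P t * \<phi> t + Q t * (norm (grad t))\<^sup>2)" if t: "t \<ge> t0" for t
    proof -
      \<comment> \<open>the coefficients of \<open><y, \<nabla>f(x)>\<close> and \<open>|x'|\<^sup>2\<close>\<close>
      define A where "A = m' t * \<beta> t + m t * (\<beta>' t - b t)"
      define B where "B = \<theta>' t / 2 + m t - \<theta> t * \<gamma> t"
      have "D t = q' t * \<phi> t + p' t / 2 * inner (y t) (y t)
          + (p t + m' t - m t * \<gamma> t) * inner (y t) (x' t) + A * inner (y t) (grad t)
          + B * inner (x' t) (x' t)
          + (q t + m t * \<beta> t + \<theta>' t * \<beta> t + \<theta> t * (\<beta>' t - b t) - \<gamma> t * \<beta> t * \<theta> t) * inner (x' t) (grad t)
          + (\<beta> t * (\<beta> t * \<theta>' t + 2 * (\<beta>' t - b t) * \<theta> t)) / 2 * inner (grad t) (grad t)"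
        unfolding D_def A_def B_def
        by (rule dissipation_identity) (simp_all add: w_def)
      \<comment> \<open>the coefficient of \<open><y, x'>\<close> vanishes by (iv)\<close>
      moreover have "p t + m' t - m t * \<gamma> t = 0"
        using iv[OF t] unfolding p_def m'_def m_def[abs_def]
        by (simp add: algebra_simps power2_eq_square)
      \<comment> \<open>the coefficient of \<open><x', \<nabla>f(x)>\<close> vanishes by (iii)\<close>
      moreover have "q t + m t * \<beta> t + \<theta>' t * \<beta> t + \<theta> t * (\<beta>' t - b t) - \<gamma> t * \<beta> t * \<theta> t = 0"
      proof -
        have "ddt t0 (\<lambda>s. \<beta> s * \<theta> s) t = \<beta> t * \<theta>' t + \<beta>' t * \<theta> t"
          using t by (intro ddt_eqI has_vector_derivative_mult \<theta>_deriv \<beta>_deriv)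
        then show ?thesis
          using iii[OF t] by (simp add: q_def m_def algebra_simps)
      qed
      moreover have "p' t / 2 * inner (y t) (y t) \<le> 0"
        using v[OF t] by (intro mult_nonpos_nonneg) (simp_all add: p'_def p_def[abs_def])
      moreover have "B * inner (x' t) (x' t) \<le> 0"
        using vi[OF t] by (intro mult_nonpos_nonneg) (simp_all add: B_def m_def \<theta>'_def algebra_simps)
      \<comment> \<open>convexity trades \<open><y, \<nabla>f(x)>\<close> for the function gap because \<open>A \<le> 0\<close> by (i)\<close>
      moreover have "A * inner (y t) (grad t) \<le> A * \<phi> t"
      proof (rule mult_left_mono_neg)
        show "\<phi> t \<le> inner (y t) (grad t)"
          using convex_above_tangent_GDERIV[OF f_convex GDERIV_x, of t z]
          by (simp add: \<phi>_def y_def inner_diff_left)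
        have "ddt t0 (\<lambda>s. \<beta> s * \<theta> s * \<sigma> s) t = \<beta>' t * m t + \<beta> t * m' t"
          using ddt_eqI[OF \<beta>m_deriv[OF t] t] by (simp add: m_def mult.assoc)
        then show "A \<le> 0"
          using i[OF t] by (simp add: A_def m_def algebra_simps)
      qed
      moreover have "q' t * \<phi> t + A * \<phi> t = - P t * \<phi> t"
        by (simp add: q'_def A_def P_def m_def algebra_simps)
      ultimately show ?thesis
        by (simp add: Q_eq[OF t] power2_norm_eq_inner)
    qed
    show ?thesis
      using deriv bound unfolding \<phi>_def by blast
  qed

  have argmin: "f z \<le> f y" if "z \<in> argmin_set f" for z y
    using that by (auto simp: argmin_set_def is_arg_min_linorder)
  have INF_eq: "(INF y. f y) = f z" if "z \<in> argmin_set f" for z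
    using argmin[OF that] by (intro cInf_eq_minimum) auto

  have antimono: "antimono_on {t0..} (energy t0 f \<beta> b c \<theta> \<sigma> \<xi> x z)" if z: "z \<in> argmin_set f" for z
  proof -
    obtain D where D: "\<And>t. t \<ge> t0 \<Longrightarrow>
        (energy t0 f \<beta> b c \<theta> \<sigma> \<xi> x z has_vector_derivative D t) (at t within {t0..})"
      "\<And>t. t \<ge> t0 \<Longrightarrow> D t \<le> - (P t * (f (x t) - f z) + Q t * (norm (grad t))\<^sup>2)"
      using energy[OF argmin[OF z]] by blast
    have "0 \<le> P t * (f (x t) - f z) + Q t * (norm (grad t))\<^sup>2" if "t \<ge> t0" for t
      using P_nonneg[OF that] Q_nonneg[OF that] argmin[OF z] by simp
    then have "D t \<le> 0" if "t \<ge> t0" for t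
      using D(2)[OF that] that by fastforce
    then show ?thesis using D(1) by (rule antimono_on_if_derivative_nonpos[rotated])
  qed

  have lower: "q t * (f (x t) - f z) \<le> energy t0 f \<beta> b c \<theta> \<sigma> \<xi> x z t"
    if "\<forall>t\<ge>t0. \<theta> t \<ge> 0" "t \<ge> t0" for t z
    using that xi_nonneg by (simp add: energy_def q_def)

  have fx_bound: "f (x t) - (INF y. f y) \<le> energy t0 f \<beta> b c \<theta> \<sigma> \<xi> x z t0 / ((c t)\<^sup>2 * b t)"
    if \<theta>: "\<forall>t\<ge>t0. \<theta> t \<ge> 0" and z: "z \<in> argmin_set f" and t: "t \<ge> t0" and q: "(c t)\<^sup>2 * b t \<noteq> 0" for z t
  proof -
    have "0 < (c t)\<^sup>2 * b t"
      using q nonneg(3)[OF t] by (simp add: order_less_le)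
    moreover have "q t * (f (x t) - f z) \<le> energy t0 f \<beta> b c \<theta> \<sigma> \<xi> x z t0"
      using lower[OF \<theta> t] monotone_onD[OF antimono[OF z], of t0 t] t by (auto intro: order_trans)
    ultimately show ?thesis
      unfolding INF_eq[OF z] by (simp add: q_def pos_le_divide_eq mult.commute)
  qed

  obtain z where z: "z \<in> argmin_set f" using f_argmin by blast
  have integrable: "set_integrable lborel {t0..} (\<lambda>t. P t * (f (x t) - f z))"
    "set_integrable lborel {t0..} (\<lambda>t. Q t * (norm (grad t))\<^sup>2)" if \<theta>: "\<forall>t\<ge>t0. \<theta> t \<ge> 0"
  proof -
    obtain D where D: "\<And>t. t \<ge> t0 \<Longrightarrow>
        (energy t0 f \<beta> b c \<theta> \<sigma> \<xi> x z has_vector_derivative D t) (at t within {t0..})"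
      "\<And>t. t \<ge> t0 \<Longrightarrow> D t \<le> - (P t * (f (x t) - f z) + Q t * (norm (grad t))\<^sup>2)"
      using energy[OF argmin[OF z]] by blast
    have nn: "0 \<le> energy t0 f \<beta> b c \<theta> \<sigma> \<xi> x z t" if "t \<ge> t0" for t
    proof -
      have "0 \<le> q t * (f (x t) - f z)"
        using argmin[OF z] nonneg(3)[OF that] by (simp add: q_def)
      then show ?thesis using lower[OF \<theta> that, of z] by linarith
    qed
    have dissipation:
      "0 \<le> P t * (f (x t) - f z) \<and> P t * (f (x t) - f z) \<le> - D t"
      "0 \<le> Q t * (norm (grad t))\<^sup>2 \<and> Q t * (norm (grad t))\<^sup>2 \<le> - D t" if "t \<ge> t0" for t
    proof -
      have "0 \<le> P t * (f (x t) - f z)" "0 \<le> Q t * (norm (grad t))\<^sup>2"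
        using P_nonneg[OF that] Q_nonneg[OF that] argmin[OF z] by simp_all
      with D(2)[OF that] show
        "0 \<le> P t * (f (x t) - f z) \<and> P t * (f (x t) - f z) \<le> - D t"
        "0 \<le> Q t * (norm (grad t))\<^sup>2 \<and> Q t * (norm (grad t))\<^sup>2 \<le> - D t"
        by linarith+
    qed
    have cont: "continuous_on {t0..} \<beta>" "continuous_on {t0..} b" "continuous_on {t0..} \<theta>"
      "continuous_on {t0..} (\<lambda>s. \<theta> s * \<sigma> s)"
      using \<beta>_diff b_diff aux_diff(1,2) by (blast intro: differentiable_imp_continuous_on)+
    have fx_meas: "set_borel_measurable lborel {t0..} (\<lambda>t. f (x t) - f z)"
      using fx_deriv
      by (intro set_borel_measurable_continuous_on continuous_on_vector_derivative) auto
    have P_meas: "set_borel_measurable lborel {t0..} P"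
    proof -
      \<comment> \<open>only the product \<open>\<theta> \<sigma>\<close> is known to be continuous, so it must not be split\<close>
      have "continuous_on {t0..} (\<lambda>t. b t * (\<theta> t * \<sigma> t))"
        by (intro continuous_on_mult cont(2,4))
      moreover have "(\<lambda>t. b t * (\<theta> t * \<sigma> t)) = (\<lambda>t. \<theta> t * b t * \<sigma> t)"
        by (simp add: fun_eq_iff)
      ultimately have "continuous_on {t0..} (\<lambda>t. \<theta> t * b t * \<sigma> t)"
        by (simp only:)
      then show ?thesis
        unfolding P_def[abs_def] r'_def
        by (intro set_borel_measurable_diff set_borel_measurable_ddt aux_diff(3))
          (rule set_borel_measurable_continuous_on)
    qed
    show "set_integrable lborel {t0..} (\<lambda>t. P t * (f (x t) - f z))"
      by (rule set_integrable_dissipation[OF D(1) nn dissipation(1)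
            set_borel_measurable_mult[OF P_meas fx_meas]])
    have grad_meas: "set_borel_measurable lborel {t0..} (\<lambda>t. (norm (grad t))\<^sup>2)"
    proof -
      have "continuous_on {t0..} grad"
        using grad_deriv by (intro continuous_on_vector_derivative) auto
      then show ?thesis
        by (intro set_borel_measurable_continuous_on continuous_intros)
    qed
    have Q_meas: "set_borel_measurable lborel {t0..} Q"
    proof -
      have "(\<lambda>s. \<theta> s * (\<beta> s)\<^sup>2) differentiable_on {t0..}"
        unfolding power2_eq_square using aux_diff(1) \<beta>_diff
        by (intro differentiable_on_mult)
      moreover have "set_borel_measurable lborel {t0..} (\<lambda>t. b t * \<theta> t * \<beta> t)"
        using cont by (intro set_borel_measurable_continuous_on continuous_intros)
      moreover have "set_borel_measurable lborel {t0..} (\<lambda>_. 1 / 2 :: real)"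
        by (intro set_borel_measurable_continuous_on continuous_on_const)
      ultimately show ?thesis
        unfolding Q_def[abs_def]
        by (intro set_borel_measurable_diff set_borel_measurable_mult[of _ _ "\<lambda>_. 1 / 2"]
            set_borel_measurable_ddt)
    qed
    show "set_integrable lborel {t0..} (\<lambda>t. Q t * (norm (grad t))\<^sup>2)"
      by (rule set_integrable_dissipation[OF D(1) nn dissipation(2)
            set_borel_measurable_mult[OF Q_meas grad_meas]])
  qed
  show ?thesis
    using antimono fx_bound integrable
    unfolding INF_eq[OF z] P_def Q_def r'_def grad_def by blast
qed

end
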